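(* Let $\mathbb F$ be an algebraically closed field, let $q\in\mathbb F$ be nonzero and not a root of unity, let $d\ge1$ be an integer, and let $t\in\mathbb F$ be nonzero and not among $\{q^{d-2n+1}\}_{n=1}^d$. On the $\boxtimes_q$-module $\mathbf V_d(t)$, $$t(x_{01}-x_{23})=\frac{[x_{30},x_{12}]}{q-q^{-1}},\qquad t^{-1}(x_{12}-x_{30})=\frac{[x_{01},x_{23}]}{q-q^{-1}}.$$
   Context: Algebras are associative with 1. $[n]_q=(q^n-q^{-n})/(q-q^{-1})$, $\mathbb Z_4=\mathbb Z/4\mathbb Z$, and $[u,v]=uv-vu$. The $q$-tetrahedron algebra $\boxtimes_q$ is the $\mathbb F$-algebra with generators (called the standard generators) $\{x_{ij}\mid i,j\in\mathbb Z_4,\ j-i=1\text{ or }j-i=2\}$ and relations: (i) $x_{ij}x_{ji}=1$ if $j-i=2$; (ii) $\frac{qx_{ij}x_{jk}-q^{-1}x_{jk}x_{ij}}{q-q^{-1}}=1$ if $(j-i,k-j)$ is one of $(1,1),(1,2),(2,1)$; (iii) $x_{ij}^3x_{k\ell}-[3]_qx_{ij}^2x_{k\ell}x_{ij}+[3]_qx_{ij}x_{k\ell}x_{ij}^2-x_{k\ell}x_{ij}^3=0$ if $j-i=k-j=\ell-k=1$. Matrices in ${\rm Mat}_{d+1}(\mathbb F)$ have rows and columns indexed by $0,\dots,d$; $M$ represents $A$ with respect to a basis $\{v_n\}_{n=0}^d$ when $Av_n=\sum_i M_{in}v_i$. Entries not mentioned below are $0$. A subscript $q^{-1}$ means that $q$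 is replaced by $q^{-1}$ in the definition (and similarly $t^{-1}$ as argument). - $Z$: $(i,j)$-entry $\delta_{i+j,d}$. - $K_q$: diagonal, $(i,i)$-entry $q^{d-2i}$. - $E_q$: $(i,i)$-entry $q^{2i-d}$; $(i-1,i)$-entry $q^d-q^{2i-2-d}$. - $G_q(t)$: $(i,i)$-entry $q^{2i-d}$; $(i-1,i)$-entry $(q^d-q^{2i-2-d})(1-tq^{d-2i+1})$. - $L_q(t)$: $(i,i)$-entry $q^{2i-d}$; $(i-1,i)$-entry $(q^d-q^{2i-2-d})(1-tq^{d-2i+1})^{-1}$. - $S_q(t)$: $(i-1,i)$-entry $(q^d-q^{2i-d-2})(1-tq^{2i-d-1})$; $(i,i-1)$-entry $(q^{2i-d}-q^{-d})q^{2i-d-1}t$; $(i,i)$-entry $q^d-(q^{2i-d}-q^{-d})q^{2i-d-1}t-(q^d-q^{2i-d})(1-tq^{2i-d+1})$. $\mathbf V_d(t)$ is the $(d+1)$-dimensional $\boxtimes_q$-module having a basis with respect to which the standard generators are represented by: $x_{01}: ZS_{q^{-1}}(t^{-1})Z$, $x_{12}: E_q$, $x_{23}: K_q$, $x_{30}: ZG_{q^{-1}}(t)Z$, $x_{02}: L_q(t)$, $x_{13}: (ZE_{q^{-1}}Z)^{-1}$, $x_{20}: (L_q(t))^{-1}$, $x_{31}: ZE_{q^{-1}}Z$. *)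

theory Defs
  imports
    "HOL-Library.Poly_Mapping"
    "HOL-Library.Numeral_Type"
    "HOL-Computational_Algebra.Polynomial"
    "HOL-Algebra.QuotRing"
    "Jordan_Normal_Form.Gauss_Jordan_Elimination"
begin

hide_const (open) Multiset.mult Polynomial.smult

section \<open>The q-tetrahedron algebra\<close>

text \<open>The ring \<open>\<int>/4\<int>\<close> is the numeral type \<^typ>\<open>4\<close>.\<close>

typedef tetra_gen = "{(i, j). j - i = 1 \<or> j - i = 2} :: (4 \<times> 4) set"
  by (rule exI[of _ "(0, 1)"]) simp

text \<open>
  Words form the free monoid, written additively, so that finitely supported functions on
  words, with the convolution product of \<^theory>\<open>HOL-Library.Poly_Mapping\<close>, are the free
  associative unital algebra.
\<close>

datatype 'g free_word = Free_Word "'g list"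

instantiation free_word :: (type) monoid_add
begin

definition zero_free_word :: "'a free_word" where
  "0 = Free_Word []"

fun plus_free_word :: "'a free_word \<Rightarrow> 'a free_word \<Rightarrow> 'a free_word" where
  "Free_Word u + Free_Word w = Free_Word (u @ w)"

instance
proof
  fix a b c :: "'a free_word"
  show "a + b + c = a + (b + c)" by (cases a; cases b; cases c) simp
  show "0 + a = a" by (cases a) (simp add: zero_free_word_def)
  show "a + 0 = a" by (cases a) (simp add: zero_free_word_def)
qed

end

type_synonym 'a tetra_free = "tetra_gen free_word \<Rightarrow>\<^sub>0 'a"

definition fscalar :: "'a::field \<Rightarrow> 'a tetra_free" where
  "fscalar c = Poly_Mapping.single 0 c"

text \<open>Only meaningful for \<open>j - i \<in> {1, 2}\<close>.\<close>

definition fgen :: "4 \<Rightarrow> 4 \<Rightarrow> 'a::field tetra_free" where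
  "fgen i j = Poly_Mapping.single (Free_Word [Abs_tetra_gen (i, j)]) 1"

definition free_ring :: "'a::field tetra_free ring" where
  "free_ring = \<lparr>carrier = UNIV, mult = (*), one = 1, zero = 0, add = (+)\<rparr>"

definition qint :: "'a::field \<Rightarrow> nat \<Rightarrow> 'a" where
  "qint q n = (q ^ n - inverse q ^ n) / (q - inverse q)"

definition tetra_rels :: "'a::field \<Rightarrow> 'a tetra_free set" where
  "tetra_rels q =
     {fgen i j * fgen j i - 1 | i j. j - i = 2}
   \<union> {fscalar (inverse (q - inverse q)) *
        (fscalar q * fgen i j * fgen j k - fscalar (inverse q) * fgen j k * fgen i j) - 1 | i j k.
        (j - i, k - j) \<in> {(1, 1), (1, 2), (2, 1)}}
   \<union> {fgen i j ^ 3 * fgen k l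
        - fscalar (qint q 3) * fgen i j ^ 2 * fgen k l * fgen i j
        + fscalar (qint q 3) * fgen i j * fgen k l * fgen i j ^ 2
        - fgen k l * fgen i j ^ 3 | i j k l.
        j - i = 1 \<and> k - j = 1 \<and> l - k = 1}"

text \<open>In the HOL-Algebra library, ideals are two-sided.\<close>

definition tetra_ideal :: "'a::field \<Rightarrow> 'a tetra_free set" where
  "tetra_ideal q = genideal free_ring (tetra_rels q)"

definition tetra_class :: "'a::field \<Rightarrow> 'a tetra_free \<Rightarrow> 'a tetra_free set" where
  "tetra_class q f = tetra_ideal q +>\<^bsub>free_ring\<^esub> f"

text \<open>
  The record type \<open>module\<close> carries the ring operations together with the scalar
  multiplication by the ground field.
\<close>

definition tetra_alg :: "'a::field \<Rightarrow> ('a, 'a tetra_free set) module" where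
  "tetra_alg q =
     \<lparr>carrier = carrier (free_ring Quot tetra_ideal q),
      mult = mult (free_ring Quot tetra_ideal q),
      one = one (free_ring Quot tetra_ideal q),
      zero = zero (free_ring Quot tetra_ideal q),
      add = add (free_ring Quot tetra_ideal q),
      smult = (\<lambda>c u. tetra_class q (fscalar c) \<otimes>\<^bsub>free_ring Quot tetra_ideal q\<^esub> u)\<rparr>"

definition tetra_x :: "'a::field \<Rightarrow> 4 \<Rightarrow> 4 \<Rightarrow> 'a tetra_free set" where
  "tetra_x q i j = tetra_class q (fgen i j)"

definition lie_bracket :: "('b, 'm) ring_scheme \<Rightarrow> 'b \<Rightarrow> 'b \<Rightarrow> 'b" where
  "lie_bracket R u v = (u \<otimes>\<^bsub>R\<^esub> v) \<ominus>\<^bsub>R\<^esub> (v \<otimes>\<^bsub>R\<^esub> u)"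

lemma ring_free_ring: "ring (free_ring :: 'a::field tetra_free ring)"
  unfolding free_ring_def
  by (rule ringI; (rule abelian_groupI monoidI)?)
     (auto simp: algebra_simps intro: exI[of _ "- x" for x])

lemma ideal_tetra_ideal: "ideal (tetra_ideal q) free_ring"
  unfolding tetra_ideal_def
  by (rule ring.genideal_ideal[OF ring_free_ring]) (simp add: free_ring_def)

lemma ring_tetra_alg: "ring (tetra_alg q)"
proof -
  interpret Q: ring "free_ring Quot tetra_ideal q"
    by (rule ideal.quotient_is_ring[OF ideal_tetra_ideal])
  show ?thesis
    by (rule ringI; (rule abelian_groupI monoidI)?)
       (auto simp: tetra_alg_def Q.m_assoc Q.a_ac Q.l_distr Q.r_distr
             intro: Q.l_neg bexI[OF _ Q.a_inv_closed])
qed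


section \<open>Modules\<close>

text \<open>
  The underlying vector space is a whole type, with scalar multiplication \<open>scale\<close>;
  \<open>act u\<close> is the action of the algebra element \<open>u\<close>.
\<close>

definition tetra_module ::
  "'a::field \<Rightarrow> ('a \<Rightarrow> 'v \<Rightarrow> 'v::ab_group_add) \<Rightarrow> ('a tetra_free set \<Rightarrow> 'v \<Rightarrow> 'v) \<Rightarrow> bool" where
  "tetra_module q scale act \<longleftrightarrow>
     vector_space scale \<and>
     (\<forall>u \<in> carrier (tetra_alg q). Vector_Spaces.linear scale scale (act u)) \<and>
     (\<forall>v. act \<one>\<^bsub>tetra_alg q\<^esub> v = v) \<and>
     (\<forall>u \<in> carrier (tetra_alg q). \<forall>w \<in> carrier (tetra_alg q). \<forall>v.
        act (u \<oplus>\<^bsub>tetra_alg q\<^esub> w) v = act u v + act w v \<and>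
        act (u \<otimes>\<^bsub>tetra_alg q\<^esub> w) v = act u (act w v)) \<and>
     (\<forall>c. \<forall>u \<in> carrier (tetra_alg q). \<forall>v. act (c \<odot>\<^bsub>tetra_alg q\<^esub> u) v = scale c (act u v))"

definition is_basis :: "nat \<Rightarrow> ('a::field \<Rightarrow> 'v \<Rightarrow> 'v::ab_group_add) \<Rightarrow> (nat \<Rightarrow> 'v) \<Rightarrow> bool" where
  "is_basis d scale b \<longleftrightarrow>
     inj_on b {0..d} \<and> \<not> Modules.module.dependent scale (b ` {0..d}) \<and>
     Modules.module.span scale (b ` {0..d}) = UNIV"

definition represents ::
  "nat \<Rightarrow> ('a::field \<Rightarrow> 'v \<Rightarrow> 'v::ab_group_add) \<Rightarrow> (nat \<Rightarrow> 'v) \<Rightarrow> 'a mat \<Rightarrow> ('v \<Rightarrow> 'v) \<Rightarrow> bool" where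
  "represents d scale b M A \<longleftrightarrow> (\<forall>n \<in> {0..d}. A (b n) = (\<Sum>i = 0..d. scale (M $$ (i, n)) (b i)))"


section \<open>The matrices\<close>

definition Z_mat :: "nat \<Rightarrow> 'a::field mat" where
  "Z_mat d = mat (d + 1) (d + 1) (\<lambda>(i, j). if i + j = d then 1 else 0)"

definition K_mat :: "nat \<Rightarrow> 'a::field \<Rightarrow> 'a mat" where
  "K_mat d q = mat (d + 1) (d + 1) (\<lambda>(i, j). if i = j then q powi (int d - 2 * int i) else 0)"

text \<open>
  In the remaining matrices a superdiagonal entry in position \<open>(i - 1, i)\<close> is given by a
  formula in \<open>i\<close>, which is the column index \<open>c\<close> below.
\<close>

definition E_mat :: "nat \<Rightarrow> 'a::field \<Rightarrow> 'a mat" where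
  "E_mat d q = mat (d + 1) (d + 1) (\<lambda>(r, c).
     if r = c then q powi (2 * int c - int d)
     else if r + 1 = c then q powi (int d) - q powi (2 * int c - 2 - int d)
     else 0)"

definition G_mat :: "nat \<Rightarrow> 'a::field \<Rightarrow> 'a \<Rightarrow> 'a mat" where
  "G_mat d q t = mat (d + 1) (d + 1) (\<lambda>(r, c).
     if r = c then q powi (2 * int c - int d)
     else if r + 1 = c then
       (q powi (int d) - q powi (2 * int c - 2 - int d)) * (1 - t * q powi (int d - 2 * int c + 1))
     else 0)"

definition L_mat :: "nat \<Rightarrow> 'a::field \<Rightarrow> 'a \<Rightarrow> 'a mat" where
  "L_mat d q t = mat (d + 1) (d + 1) (\<lambda>(r, c).
     if r = c then q powi (2 * int c - int d)
     else if r + 1 = c then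
       (q powi (int d) - q powi (2 * int c - 2 - int d)) *
       inverse (1 - t * q powi (int d - 2 * int c + 1))
     else 0)"

definition S_mat :: "nat \<Rightarrow> 'a::field \<Rightarrow> 'a \<Rightarrow> 'a mat" where
  "S_mat d q t = mat (d + 1) (d + 1) (\<lambda>(r, c).
     if r + 1 = c then
       (q powi (int d) - q powi (2 * int c - int d - 2)) * (1 - t * q powi (2 * int c - int d - 1))
     else if r = c + 1 then
       (q powi (2 * int r - int d) - q powi (- int d)) * q powi (2 * int r - int d - 1) * t
     else if r = c then
       q powi (int d)
       - (q powi (2 * int r - int d) - q powi (- int d)) * q powi (2 * int r - int d - 1) * t
       - (q powi (int d) - q powi (2 * int r - int d)) * (1 - t * q powi (2 * int r - int d + 1))
     else 0)"

text \<open>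
  The two matrices inverted below are conjugate by \<open>Z\<close> to, respectively equal to, triangular
  matrices with nonzero diagonal (for \<open>q \<noteq> 0\<close>), so \<^const>\<open>mat_inverse\<close> returns \<^const>\<open>Some\<close>.
\<close>

definition is_V ::
  "'a::field \<Rightarrow> nat \<Rightarrow> 'a \<Rightarrow> ('a \<Rightarrow> 'v \<Rightarrow> 'v::ab_group_add) \<Rightarrow> ('a tetra_free set \<Rightarrow> 'v \<Rightarrow> 'v) \<Rightarrow> bool"
where
  "is_V q d t scale act \<longleftrightarrow>
     tetra_module q scale act \<and>
     (\<exists>b. is_basis d scale b \<and>
        represents d scale b (Z_mat d * S_mat d (inverse q) (inverse t) * Z_mat d) (act (tetra_x q 0 1)) \<and>
        represents d scale b (E_mat d q) (act (tetra_x q 1 2)) \<and>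
        represents d scale b (K_mat d q) (act (tetra_x q 2 3)) \<and>
        represents d scale b (Z_mat d * G_mat d (inverse q) t * Z_mat d) (act (tetra_x q 3 0)) \<and>
        represents d scale b (L_mat d q t) (act (tetra_x q 0 2)) \<and>
        represents d scale b (the (mat_inverse (Z_mat d * E_mat d (inverse q) * Z_mat d)))
          (act (tetra_x q 1 3)) \<and>
        represents d scale b (the (mat_inverse (L_mat d q t))) (act (tetra_x q 2 0)) \<and>
        represents d scale b (Z_mat d * E_mat d (inverse q) * Z_mat d) (act (tetra_x q 3 1)))"

end

theory Submission
  imports Defs
begin

text \<open>
  Only four generators occur, and in the given basis all four are banded: \<open>x\<^sub>1\<^sub>2\<close> is upper
  bidiagonal, \<open>x\<^sub>3\<^sub>0\<close> is lower bidiagonal, \<open>x\<^sub>2\<^sub>3\<close> is diagonal and \<open>x\<^sub>0\<^sub>1\<close> is tridiagonal. Both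
  sides of each relation are therefore tridiagonal, and each relation is a comparison of at most
  three coefficients of the image of a basis vector. Since \<open>x\<^sub>1\<^sub>2\<close> and \<open>x\<^sub>3\<^sub>0\<close> have the same
  diagonal, \<open>commutator_lower_upper\<close> yields the bracket of the first relation in closed form, and
  \<open>x\<^sub>1\<^sub>2 - x\<^sub>3\<^sub>0\<close> has no diagonal part, like the bracket of the second relation, which is given by
  \<open>commutator_tridiagonal_diagonal\<close>.

  Two devices turn the comparison into identities of rational functions. The basis is continued
  by zero to all integers; the coefficients that would lead from a vector just outside back into
  the basis vanish, so that
  \<open>represents_tridiagonal\<close> gives one formula for the image of every vector and the ends of the
  basis need no separate treatment. And every entry is a rational expression in \<open>q\<close>, \<open>t\<close>,
  \<open>Q = q powi d\<close> and \<open>y n = q powi (2 * n - d)\<close>, where passing from \<open>n\<close> to \<open>n + 1\<close> multiplies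
  \<open>y n\<close> by \<open>q^2\<close>. The relations then follow for all vectors because both sides act linearly.
\<close>


section \<open>The action of the algebra operations\<close>

lemma tetra_x_closed: "tetra_x q i j \<in> carrier (tetra_alg q)"
  by (auto simp: tetra_alg_def FactRing_def A_RCOSETS_def' tetra_x_def tetra_class_def
      free_ring_def)

lemma act_diff:
  assumes "tetra_module q scale act"
    and u: "u \<in> carrier (tetra_alg q)" and w: "w \<in> carrier (tetra_alg q)"
  shows "act (u \<ominus>\<^bsub>tetra_alg q\<^esub> w) v = act u v - act w v"
proof -
  interpret R: ring "tetra_alg q" by (rule ring_tetra_alg)
  have "(u \<ominus>\<^bsub>tetra_alg q\<^esub> w) \<oplus>\<^bsub>tetra_alg q\<^esub> w = u"
    using u w by (simp add: R.minus_eq R.a_assoc R.l_neg)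
  moreover have "act ((u \<ominus>\<^bsub>tetra_alg q\<^esub> w) \<oplus>\<^bsub>tetra_alg q\<^esub> w) v
      = act (u \<ominus>\<^bsub>tetra_alg q\<^esub> w) v + act w v"
    using assms(1) u w unfolding tetra_module_def by (meson R.minus_closed)
  ultimately show ?thesis by simp
qed

lemma act_smult_diff:
  assumes "tetra_module q scale act"
    and "u \<in> carrier (tetra_alg q)" and "w \<in> carrier (tetra_alg q)"
  shows "act (c \<odot>\<^bsub>tetra_alg q\<^esub> (u \<ominus>\<^bsub>tetra_alg q\<^esub> w)) v = scale c (act u v - act w v)"
proof -
  interpret R: ring "tetra_alg q" by (rule ring_tetra_alg)
  show ?thesis
    using assms act_diff[OF assms] unfolding tetra_module_def by (metis R.minus_closed)
qed

lemma act_smult_bracket: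
  assumes "tetra_module q scale act"
    and "u \<in> carrier (tetra_alg q)" and "w \<in> carrier (tetra_alg q)"
  shows "act (c \<odot>\<^bsub>tetra_alg q\<^esub> lie_bracket (tetra_alg q) u w) v
    = scale c (act u (act w v) - act w (act u v))"
proof -
  interpret R: ring "tetra_alg q" by (rule ring_tetra_alg)
  have "act (u \<otimes>\<^bsub>tetra_alg q\<^esub> w) v = act u (act w v)"
    and "act (w \<otimes>\<^bsub>tetra_alg q\<^esub> u) v = act w (act u v)"
    using assms unfolding tetra_module_def by auto
  then show ?thesis
    using assms unfolding lie_bracket_def by (simp add: act_smult_diff[OF assms(1)])
qed


lemma linear_act_smult:
  assumes "tetra_module q scale act" and "u \<in> carrier (tetra_alg q)"
  shows "Vector_Spaces.linear scale scale (act (c \<odot>\<^bsub>tetra_alg q\<^esub> u))"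
proof -
  interpret I: ideal "tetra_ideal q" free_ring by (rule ideal_tetra_ideal)
  interpret Q: ring "free_ring Quot tetra_ideal q" by (rule I.quotient_is_ring)
  have "tetra_class q (fscalar c) \<in> carrier (free_ring Quot tetra_ideal q)"
    by (auto simp: FactRing_def A_RCOSETS_def' tetra_class_def free_ring_def)
  then have "c \<odot>\<^bsub>tetra_alg q\<^esub> u \<in> carrier (tetra_alg q)"
    using assms(2) by (simp add: tetra_alg_def)
  then show ?thesis using assms(1) by (simp add: tetra_module_def)
qed


section \<open>Tridiagonal operators on a basis continued by zero\<close>

text \<open>
  With the basis continued by \<open>0\<close> to all integer indices, the first and last basis vectors obey
  the same formulas as the others.
\<close>

definition basis_ext :: "nat \<Rightarrow> (nat \<Rightarrow> 'v) \<Rightarrow> int \<Rightarrow> 'v::zero" where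
  "basis_ext d b n = (if 0 \<le> n \<and> n \<le> int d then b (nat n) else 0)"

lemma linear_eq_on_basis_ext:
  assumes "Vector_Spaces.linear scale scale f" and "Vector_Spaces.linear scale scale g"
    and "is_basis d scale b"
    and eq: "\<And>n. f (basis_ext d b n) = g (basis_ext d b n)"
  shows "f v = g v"
proof -
  interpret F: Vector_Spaces.linear scale scale f by fact
  interpret G: Vector_Spaces.linear scale scale g by fact
  have "v \<in> F.vs1.span (b ` {0..d})"
    using assms(3) by (auto simp: is_basis_def)
  moreover have "f x = g x" if x: "x \<in> b ` {0..d}" for x
  proof -
    obtain i where "i \<in> {0..d}" "x = b i" using x by blast
    then show ?thesis using eq[of "int i"] by (simp add: basis_ext_def)
  qed
  ultimately show ?thesis
    by (rule vector_space_pair.linear_eq_on[OF vector_space_pair.intro[OF F.vs1.vector_space_axioms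
            F.vs1.vector_space_axioms] assms(1,2)])
qed

text \<open>
  The vectors with index \<open>- 1\<close> and \<open>d + 1\<close> are zero but have a nonzero neighbour inside the
  basis. The formula for their images is correct because the coefficient of that neighbour is
  assumed to vanish.
\<close>

lemma represents_tridiagonal:
  fixes lo di up :: "int \<Rightarrow> 'a::field"
  assumes lin: "Vector_Spaces.linear scale scale A"
    and rep: "represents d scale b M A"
    and M: "\<And>r c. r \<le> d \<Longrightarrow> c \<le> d \<Longrightarrow> M $$ (r, c) =
       (if r + 1 = c then up (int c) else if r = c then di (int c)
        else if r = c + 1 then lo (int c) else 0)"
    and ends: "up (int d + 1) = 0" "lo (-1) = 0"
  shows "A (basis_ext d b n) =
    scale (up n) (basis_ext d b (n - 1)) + scale (di n) (basis_ext d b n)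
    + scale (lo n) (basis_ext d b (n + 1))"
proof -
  interpret A: Vector_Spaces.linear scale scale A by fact
  consider "0 \<le> n" "n \<le> int d" | "n = -1" | "n = int d + 1" | "n < -1" | "n > int d + 1"
    by linarith
  then show ?thesis
  proof cases
    case 1
    define c where "c = nat n"
    have n: "n = int c" and c: "c \<le> d" using 1 by (auto simp: c_def)
    (* For c = 0 the truncated index c - 1 is 0, a genuine index, hence the inner test. *)
    have "A (b c) = (\<Sum>i = 0..d. scale (M $$ (i, c)) (b i))"
      using rep c by (auto simp: represents_def)
    also have "\<dots> = (\<Sum>i = 0..d. (if i = c - 1 then if c = 0 then 0 else scale (up n) (b i) else 0)
        + (if i = c then scale (di n) (b i) else 0) + (if i = c + 1 then scale (lo n) (b i) else 0))"
      by (rule sum.cong) (use c in \<open>auto simp: M n\<close>)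
    also have "\<dots> = (if c = 0 then 0 else scale (up n) (b (c - 1))) + scale (di n) (b c)
        + (if c + 1 \<le> d then scale (lo n) (b (c + 1)) else 0)"
      using c by (auto simp: sum.distrib)
    finally show ?thesis
      using c by (auto simp: n basis_ext_def nat_diff_distrib' nat_add_distrib)
  qed (use ends in \<open>auto simp: basis_ext_def A.zero\<close>)
qed

text \<open>
  Two operators with the same diagonal \<open>e\<close>, one raising and one lowering the index. The two
  orders of composition weight each off-diagonal step by the diagonal entry at its source or at
  its target, so the commutator sees only differences of neighbouring diagonal entries there.
\<close>

lemma commutator_lower_upper:
  assumes "Vector_Spaces.linear scale scale A" and "Vector_Spaces.linear scale scale B"
    and A: "\<And>n::int. A (v n) = scale (e n) (v n) + scale (g n) (v (n + 1))"
    and B: "\<And>n::int. B (v n) = scale (f n) (v (n - 1)) + scale (e n) (v n)"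
  shows "A (B (v n)) - B (A (v n)) =
    scale (f n * (e (n - 1) - e n)) (v (n - 1))
    + scale (f n * g (n - 1) - g n * f (n + 1)) (v n)
    + scale (g n * (e n - e (n + 1))) (v (n + 1))"
proof -
  interpret A: Vector_Spaces.linear scale scale A by fact
  interpret B: Vector_Spaces.linear scale scale B by fact
  show ?thesis
    by (simp add: A B A.add A.scale B.add B.scale A.vs1.scale_right_distrib
        A.vs1.scale_left_diff_distrib right_diff_distrib mult.commute)
qed

text \<open>
  The commutator with a diagonal operator multiplies each matrix entry by a difference of
  eigenvalues. The main diagonal dies, as it must if the result is to be a multiple of the
  difference of two operators with equal diagonals.
\<close>

lemma commutator_tridiagonal_diagonal:
  assumes "Vector_Spaces.linear scale scale A" and "Vector_Spaces.linear scale scale B"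
    and A: "\<And>n::int. A (v n) = scale (up n) (v (n - 1)) + scale (di n) (v n)
      + scale (lo n) (v (n + 1))"
    and B: "\<And>n::int. B (v n) = scale (k n) (v n)"
  shows "A (B (v n)) - B (A (v n)) =
    scale (up n * (k n - k (n - 1))) (v (n - 1)) + scale (lo n * (k n - k (n + 1))) (v (n + 1))"
proof -
  interpret A: Vector_Spaces.linear scale scale A by fact
  interpret B: Vector_Spaces.linear scale scale B by fact
  show ?thesis
    by (simp add: A B A.add A.scale B.add B.scale A.vs1.scale_right_distrib
        A.vs1.scale_left_diff_distrib right_diff_distrib mult.commute)
qed

text \<open>Conjugation by \<open>Z\<close> reverses the order of the basis.\<close>

lemma Z_mat_conj_index:
  assumes "r \<le> d" "c \<le> d"
  shows "(Z_mat d * mat (d + 1) (d + 1) f * Z_mat d) $$ (r, c) = f (d - r, d - c)"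
proof -
  let ?M = "mat (d + 1) (d + 1) f"
  have ZM: "(Z_mat d * ?M) $$ (r, j) = f (d - r, j)" if "j \<le> d" for j
  proof -
    have "(Z_mat d * ?M) $$ (r, j) = (\<Sum>i = 0..<d+1. (if r + i = d then 1 else 0) * f (i, j))"
      using assms that by (simp add: Z_mat_def scalar_prod_def)
    also have "\<dots> = (\<Sum>i = 0..<d+1. if i = d - r then f (i, j) else 0)"
      by (rule sum.cong) (use assms in auto)
    finally show ?thesis by simp
  qed
  have "(Z_mat d * ?M * Z_mat d) $$ (r, c)
      = (\<Sum>j = 0..<d+1. (Z_mat d * ?M) $$ (r, j) * (if j + c = d then 1 else 0))"
    using assms by (simp add: Z_mat_def scalar_prod_def)
  also have "\<dots> = (\<Sum>j = 0..<d+1. if j = d - c then f (d - r, j) else 0)"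
    by (rule sum.cong) (use assms ZM in auto)
  finally show ?thesis by simp
qed


section \<open>The generators and the two relations\<close>

theorem lemma9p4:
  fixes q t :: "'a::alg_closed_field"
    and d :: nat
    and scale :: "'a \<Rightarrow> 'v \<Rightarrow> 'v::ab_group_add"
    and act :: "'a tetra_free set \<Rightarrow> 'v \<Rightarrow> 'v"
  assumes "q \<noteq> 0" and "\<forall>n>0. q ^ n \<noteq> 1"
    and "d \<ge> 1"
    and "t \<noteq> 0" and "t \<notin> (\<lambda>n. q powi (int d - 2 * int n + 1)) ` {1..d}"
    and "is_V q d t scale act"
  shows "(\<forall>v. act (t \<odot>\<^bsub>tetra_alg q\<^esub> (tetra_x q 0 1 \<ominus>\<^bsub>tetra_alg q\<^esub> tetra_x q 2 3)) v
            = act (inverse (q - inverse q) \<odot>\<^bsub>tetra_alg q\<^esub>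
                    lie_bracket (tetra_alg q) (tetra_x q 3 0) (tetra_x q 1 2)) v) \<and>
         (\<forall>v. act (inverse t \<odot>\<^bsub>tetra_alg q\<^esub> (tetra_x q 1 2 \<ominus>\<^bsub>tetra_alg q\<^esub> tetra_x q 3 0)) v
            = act (inverse (q - inverse q) \<odot>\<^bsub>tetra_alg q\<^esub>
                    lie_bracket (tetra_alg q) (tetra_x q 0 1) (tetra_x q 2 3)) v)"
proof -
  have tm: "tetra_module q scale act" using assms(6) by (simp add: is_V_def)
  obtain b where basis: "is_basis d scale b"
    and r01: "represents d scale b (Z_mat d * S_mat d (inverse q) (inverse t) * Z_mat d)
      (act (tetra_x q 0 1))"
    and r12: "represents d scale b (E_mat d q) (act (tetra_x q 1 2))"
    and r23: "represents d scale b (K_mat d q) (act (tetra_x q 2 3))"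
    and r30: "represents d scale b (Z_mat d * G_mat d (inverse q) t * Z_mat d)
      (act (tetra_x q 3 0))"
    using assms(6) unfolding is_V_def by blast
  have lin: "Vector_Spaces.linear scale scale (act (tetra_x q i j))" for i j
    using tm tetra_x_closed unfolding tetra_module_def by blast
  interpret V: vector_space scale using tm by (simp add: tetra_module_def)
  let ?b = "basis_ext d b"
  define y where "y n = q powi (2 * n - int d)" for n
  define Q where "Q = q powi int d"
  have Q0: "Q \<noteq> 0" and y0: "y n \<noteq> 0" for n
    using \<open>q \<noteq> 0\<close> by (simp_all add: Q_def y_def)
  have "q^2 \<noteq> 1" using assms(2) by simp
  then have "q \<noteq> inverse q"
    using \<open>q \<noteq> 0\<close> by (auto simp: power2_eq_square field_simps)
  have shift: "q powi (2 * n - int d + k) = y n * q powi k" for n k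
    using \<open>q \<noteq> 0\<close> by (simp add: y_def power_int_add)
  have iq: "(inverse q) powi k = q powi (- k)" for k
    by (simp add: power_int_inverse power_int_minus)
  have ysuc: "y (n + 1) = y n * q^2" for n
    using shift[of n 2] by (simp add: y_def algebra_simps)
  have ypred: "y (n - 1) = y n / q^2" for n
    using shift[of n "-2"] by (simp add: y_def algebra_simps power_int_minus divide_inverse)
  have Qinv: "q powi (- int d) = 1 / Q"
    by (simp add: Q_def power_int_minus divide_inverse)
  (* The exponents below are written exactly as they occur in the entries of the matrices. *)
  have ypow: "q powi (2 * int r - int d) = y r" "q powi (2 * int r - 2 - int d) = y r / q^2"
    "q powi (int d - 2 * int r) = 1 / y r" for r
    using shift[of r 0] shift[of r "-2"] power_int_minus[of q "2 * int r - int d"]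
    by (simp_all add: y_def algebra_simps power_int_minus divide_inverse)
  (* Replacing q by its inverse and reversing the basis leave y unchanged, so the matrices
     conjugated by Z have entries in the same variable as the others. *)
  have yflip: "inverse q powi (2 * int (d - r) - int d) = y r"
    "inverse q powi (2 * int (d - r) - 2 - int d) = y r * q^2"
    "inverse q powi (2 * int (d - r) - int d - 2) = y r * q^2"
    "inverse q powi (2 * int (d - r) - int d - 1) = y r * q"
    "inverse q powi (2 * int (d - r) - int d + 1) = y r / q"
    "inverse q powi (int d - 2 * int (d - r) + 1) = 1 / (y r * q)" if "r \<le> d" for r
    using shift[of r 0] shift[of r 2] shift[of r 1] shift[of r "-1"] that
      power_int_minus[of q "2 * int r - int d + 1"]
    by (simp_all add: iq of_nat_diff y_def algebra_simps power_int_minus divide_inverse)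
  have Qflip: "inverse q powi int d = 1 / Q" "inverse q powi (- int d) = Q"
    by (simp_all only: iq Qinv, simp add: Q_def)
  (* These values make the coefficients leading back into the basis vanish. *)
  have y_end: "y (int d) = Q" "y (int d + 1) = Q * q^2" "y (- 1) = 1 / (Q * q^2)"
    using ysuc[of "int d"] ypred[of 0] Qinv by (simp_all add: y_def Q_def)
  have rev_index: "(d - r + 1 = d - c) = (r = c + 1)" "(d - r = d - c + 1) = (r + 1 = c)"
    "(d - r = d - c) = (r = c)" if "r \<le> d" "c \<le> d" for r c :: nat
    using that by auto

  let ?A = "\<lambda>i j. act (tetra_x q i j)"
  (* The off-diagonal coefficients of x12 and x30, then all coefficients of x01. A coefficient is
     indexed by the basis vector acted on, whereas an entry of S below the diagonal, which Z moves
     above it, is given through its row: hence the shift by one in up. *)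
  define f where "f n = Q - y n / q^2" for n
  define g where "g n = (1 / Q - y n * q^2) * (1 - t / (y n * q))" for n
  define up where "up n = (y (n - 1) - Q) * (y (n - 1) * q) / t" for n
  define di where
    "di n = 1 / Q - (y n - Q) * (y n * q / t) - (1 / Q - y n) * (1 - y n / (q * t))" for n
  define lo where "lo n = (1 / Q - y n * q^2) * (1 - y n * q / t)" for n
  have x12: "?A 1 2 (?b n) = scale (f n) (?b (n - 1)) + scale (y n) (?b n)" for n
  proof -
    have "?A 1 2 (?b n) = scale (f n) (?b (n - 1)) + scale (y n) (?b n) + scale 0 (?b (n + 1))"
      by (rule represents_tridiagonal[OF lin r12, where lo = "\<lambda>_. 0"])
        (use ypow \<open>q \<noteq> 0\<close> in \<open>auto simp: E_mat_def f_def y_end Q_def\<close>)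
    then show ?thesis by simp
  qed
  have x23: "?A 2 3 (?b n) = scale (1 / y n) (?b n)" for n
  proof -
    have "?A 2 3 (?b n) = scale 0 (?b (n - 1)) + scale (1 / y n) (?b n) + scale 0 (?b (n + 1))"
      by (rule represents_tridiagonal[OF lin r23, where up = "\<lambda>_. 0"
            and di = "\<lambda>n. 1 / y n" and lo = "\<lambda>_. 0"])
        (use ypow in \<open>auto simp: K_mat_def\<close>)
    then show ?thesis by simp
  qed
  have x30: "?A 3 0 (?b n) = scale (y n) (?b n) + scale (g n) (?b (n + 1))" for n
  proof -
    have "?A 3 0 (?b n) = scale 0 (?b (n - 1)) + scale (y n) (?b n) + scale (g n) (?b (n + 1))"
    proof (rule represents_tridiagonal[OF lin r30, where up = "\<lambda>_. 0"])
      fix r c :: nat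
      assume rc: "r \<le> d" "c \<le> d"
      have "(Z_mat d * G_mat d (inverse q) t * Z_mat d) $$ (r, c) =
         (if r = c then y c
          else if r = c + 1 then (1 / Q - y c * q^2) * (1 - t * (1 / (y c * q)))
          else 0)"
        unfolding G_mat_def Z_mat_conj_index[OF rc] prod.case rev_index[OF rc]
          yflip[OF rc(2)] Qflip ..
      then show "(Z_mat d * G_mat d (inverse q) t * Z_mat d) $$ (r, c) =
         (if r + 1 = c then 0 else if r = c then y (int c)
          else if r = c + 1 then g (int c) else 0)"
        by (auto simp: g_def)
    qed (use \<open>q \<noteq> 0\<close> in \<open>simp_all add: g_def y_end\<close>)
    then show ?thesis by simp
  qed
  have x01: "?A 0 1 (?b n) = scale (up n) (?b (n - 1)) + scale (di n) (?b n)
      + scale (lo n) (?b (n + 1))" for n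
  proof (rule represents_tridiagonal[OF lin r01])
    fix r c :: nat
    assume rc: "r \<le> d" "c \<le> d"
    have "(Z_mat d * S_mat d (inverse q) (inverse t) * Z_mat d) $$ (r, c) =
       (if r = c + 1 then (1 / Q - y c * q^2) * (1 - inverse t * (y c * q))
        else if r + 1 = c then (y r - Q) * (y r * q) * inverse t
        else if r = c then 1 / Q - (y r - Q) * (y r * q) * inverse t
          - (1 / Q - y r) * (1 - inverse t * (y r / q))
        else 0)"
      unfolding S_mat_def Z_mat_conj_index[OF rc] prod.case rev_index[OF rc]
        yflip[OF rc(1)] yflip[OF rc(2)] Qflip ..
    then show "(Z_mat d * S_mat d (inverse q) (inverse t) * Z_mat d) $$ (r, c) =
       (if r + 1 = c then up (int c) else if r = c then di (int c)
        else if r = c + 1 then lo (int c) else 0)"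
      by (auto simp: up_def di_def lo_def divide_inverse mult_ac)
  qed (use \<open>q \<noteq> 0\<close> in \<open>simp_all add: up_def lo_def y_end\<close>)

  have bracket1: "?A 3 0 (?A 1 2 (?b n)) - ?A 1 2 (?A 3 0 (?b n))
    = scale ((q - inverse q) * t) (?A 0 1 (?b n) - ?A 2 3 (?b n))" for n
  proof -
    note nonzero = y0[of n] Q0 \<open>q \<noteq> 0\<close> \<open>t \<noteq> 0\<close>
    have up: "f n * (y (n - 1) - y n) = (q - inverse q) * t * up n"
      unfolding f_def up_def ypred
      using nonzero by (simp add: field_simps power2_eq_square)
    have di: "f n * g (n - 1) - g n * f (n + 1) = (q - inverse q) * t * (di n - 1 / y n)"
      unfolding f_def g_def di_def ysuc ypred
      using nonzero by (simp add: field_simps power2_eq_square)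
    have lo: "g n * (y n - y (n + 1)) = (q - inverse q) * t * lo n"
      unfolding g_def lo_def ysuc
      using nonzero by (simp add: field_simps power2_eq_square)
    show ?thesis
      unfolding commutator_lower_upper[OF lin lin x30 x12] up di lo x01 x23
      by (simp add: V.scale_right_distrib V.scale_right_diff_distrib V.scale_left_diff_distrib
          right_diff_distrib)
  qed
  have bracket2: "?A 0 1 (?A 2 3 (?b n)) - ?A 2 3 (?A 0 1 (?b n))
    = scale ((q - inverse q) * inverse t) (?A 1 2 (?b n) - ?A 3 0 (?b n))" for n
  proof -
    note nonzero = y0[of n] Q0 \<open>q \<noteq> 0\<close> \<open>t \<noteq> 0\<close>
    have up: "up n * (1 / y n - 1 / y (n - 1)) = (q - inverse q) * inverse t * f n"
      unfolding up_def f_def ypred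
      using nonzero by (simp add: field_simps power2_eq_square)
    have lo: "lo n * (1 / y n - 1 / y (n + 1)) = - ((q - inverse q) * inverse t * g n)"
      unfolding lo_def g_def ysuc
      using nonzero by (simp add: field_simps power2_eq_square)
    show ?thesis
      unfolding commutator_tridiagonal_diagonal[OF lin lin x01 x23] up lo x12 x30
      by (simp add: V.scale_right_distrib V.scale_right_diff_distrib)
  qed

  have lin_diff: "Vector_Spaces.linear scale scale
      (act (c \<odot>\<^bsub>tetra_alg q\<^esub> (tetra_x q i j \<ominus>\<^bsub>tetra_alg q\<^esub> tetra_x q k l)))"
    and lin_bracket: "Vector_Spaces.linear scale scale
      (act (c \<odot>\<^bsub>tetra_alg q\<^esub> lie_bracket (tetra_alg q) (tetra_x q i j) (tetra_x q k l)))"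
    for c i j k l
  proof -
    interpret ring "tetra_alg q" by (rule ring_tetra_alg)
    show "Vector_Spaces.linear scale scale
      (act (c \<odot>\<^bsub>tetra_alg q\<^esub> (tetra_x q i j \<ominus>\<^bsub>tetra_alg q\<^esub> tetra_x q k l)))"
      "Vector_Spaces.linear scale scale
      (act (c \<odot>\<^bsub>tetra_alg q\<^esub> lie_bracket (tetra_alg q) (tetra_x q i j) (tetra_x q k l)))"
      by (simp_all add: linear_act_smult[OF tm] lie_bracket_def tetra_x_closed)
  qed
  have cancel: "scale (inverse (q - inverse q)) (scale ((q - inverse q) * c) w) = scale c w" for c w
    using \<open>q \<noteq> inverse q\<close> by simp
  show ?thesis
  proof (rule conjI; intro allI; rule linear_eq_on_basis_ext[OF lin_diff lin_bracket basis])
    fix n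
    show "act (t \<odot>\<^bsub>tetra_alg q\<^esub> (tetra_x q 0 1 \<ominus>\<^bsub>tetra_alg q\<^esub> tetra_x q 2 3)) (?b n)
      = act (inverse (q - inverse q) \<odot>\<^bsub>tetra_alg q\<^esub>
          lie_bracket (tetra_alg q) (tetra_x q 3 0) (tetra_x q 1 2)) (?b n)"
      unfolding act_smult_diff[OF tm tetra_x_closed tetra_x_closed]
        act_smult_bracket[OF tm tetra_x_closed tetra_x_closed] bracket1 cancel ..
    show "act (inverse t \<odot>\<^bsub>tetra_alg q\<^esub> (tetra_x q 1 2 \<ominus>\<^bsub>tetra_alg q\<^esub> tetra_x q 3 0)) (?b n)
      = act (inverse (q - inverse q) \<odot>\<^bsub>tetra_alg q\<^esub>
          lie_bracket (tetra_alg q) (tetra_x q 0 1) (tetra_x q 2 3)) (?b n)"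
      unfolding act_smult_diff[OF tm tetra_x_closed tetra_x_closed]
        act_smult_bracket[OF tm tetra_x_closed tetra_x_closed] bracket2 cancel ..
  qed
qed

end
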